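(* Let $K$ be a partition of $X$ parametrized by $(T,\mathcal A,\phi)$ and let $(T,\mathcal B)$ be the associated resolution. Define a relation $\sim$ on $\Sigma$ by: $\omega\sim\tau$ if and only if $\sup_{n\ge1}d_{(T,\mathcal B)}([\omega]_n,[\tau]_n)<+\infty$. This is an equivalence relation. Let $\mathcal O_*$ be the quotient topology on $\Sigma/\!\sim$ induced from the metric $\rho_*$ on $\Sigma$. Then $(\Sigma/\!\sim,\mathcal O_* )=(X,\mathcal O)$, where $\Sigma/\!\sim$ is identified with $X$ through the map $\sigma:\Sigma\to X$; that is, $\omega\sim\tau$ if and only if $\sigma(\omega)=\sigma(\tau)$, and the map $\Sigma/\!\sim\ \to X$ induced by $\sigma$ is a homeomorphism.
   Context: Setting. $T$ is a countably infinite set, $\mathcal A:T\times T\to\{0,1\}$ is symmetric and vanishes on the diagonal, the graph on $T$ with edges $\{(w,v):\mathcal A(w,v)=1\}$ is a locally finite tree, and $\phi\in T$ is a fixed root. For $w\in T$: $|w|$ is the tree distance from $\phi$ to $w$; $(T)_m=\{w:|w|=m\}$; $\pi(w)$ is the neighbour of $w$ on the geodesic from $\phi$ to $w$ ($\pi(\phi)=\phi$); $S(w)$ is the set of neighbours of $w$ other than $\pi(w)$. $\Sigma$ is the set of infinite geodesic rays $\omega=([\omega]_0=\phi,[\omega]_1,[\omega]_2,\ldots)$ of the tree starting at $\phi$, with the metric $\rho_*(\omega,\tau)=2^{-\max\{m:[\omega]_m=[\tau]_m\}}$ for $\omega\ne\tau$ and $\rho_*(\omega,\omega)=0$. $(X,\mathcal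 O)$ is a compact metrizable topological space with no isolated point. A partition $K$ of $X$ parametrized by $(T,\mathcal A,\phi)$ assigns to each $w\in T$ a nonempty compact set $K_w\subseteq X$ such that $K_\phi=X$, $K_w=\bigcup_{v\in S(w)}K_v$ for all $w$, and $\bigcap_{m\ge0}K_{[\omega]_m}$ is a single point, denoted $\sigma(\omega)$, for every $\omega\in\Sigma$. Resolution. $(T,\mathcal B)$ is the graph on $T$ whose edges are the edges of the tree together with the horizontal edges: pairs $(w,v)$ with $|w|=|v|$ and $K_w\cap K_v\neq\emptyset$. $d_{(T,\mathcal B)}$ is its shortest path (graph) metric. *)

theory Defs
  imports "HOL-Analysis.Analysis"
begin

section \<open>Graphs given by adjacency matrices\<close>

definition adjacency_matrix :: "'a set \<Rightarrow> ('a \<Rightarrow> 'a \<Rightarrow> nat) \<Rightarrow> bool" where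
  "adjacency_matrix T A \<longleftrightarrow>
     (\<forall>w\<in>T. \<forall>v\<in>T. A w v \<in> {0, 1} \<and> A w v = A v w) \<and> (\<forall>w\<in>T. A w w = 0)"

definition neighbours :: "'a set \<Rightarrow> ('a \<Rightarrow> 'a \<Rightarrow> nat) \<Rightarrow> 'a \<Rightarrow> 'a set" where
  "neighbours T A w = {v \<in> T. A w v = 1}"

definition locally_finite_graph :: "'a set \<Rightarrow> ('a \<Rightarrow> 'a \<Rightarrow> nat) \<Rightarrow> bool" where
  "locally_finite_graph T A \<longleftrightarrow> (\<forall>w\<in>T. finite (neighbours T A w))"

text \<open>A path is given by its list of vertices, so its number of edges is one less than its length.\<close>

definition graph_path :: "'a set \<Rightarrow> ('a \<Rightarrow> 'a \<Rightarrow> nat) \<Rightarrow> 'a \<Rightarrow> 'a list \<Rightarrow> 'a \<Rightarrow> bool" where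
  "graph_path T A w p v \<longleftrightarrow>
     p \<noteq> [] \<and> set p \<subseteq> T \<and> hd p = w \<and> last p = v \<and> successively (\<lambda>x y. A x y = 1) p"

text \<open>The value is \<open>\<infinity>\<close> if there is no path.\<close>

definition graph_dist :: "'a set \<Rightarrow> ('a \<Rightarrow> 'a \<Rightarrow> nat) \<Rightarrow> 'a \<Rightarrow> 'a \<Rightarrow> enat" where
  "graph_dist T A w v = (INF p\<in>{p. graph_path T A w p v}. enat (length p - 1))"

definition tree_graph :: "'a set \<Rightarrow> ('a \<Rightarrow> 'a \<Rightarrow> nat) \<Rightarrow> bool" where
  "tree_graph T A \<longleftrightarrow> (\<forall>w\<in>T. \<forall>v\<in>T. \<exists>!p. graph_path T A w p v \<and> distinct p)"

section \<open>Rooted trees\<close>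

text \<open>In a tree the geodesic between two vertices is the unique simple path between them.\<close>

definition geodesic :: "'a set \<Rightarrow> ('a \<Rightarrow> 'a \<Rightarrow> nat) \<Rightarrow> 'a \<Rightarrow> 'a \<Rightarrow> 'a list" where
  "geodesic T A w v = (THE p. graph_path T A w p v \<and> distinct p)"

definition parent :: "'a set \<Rightarrow> ('a \<Rightarrow> 'a \<Rightarrow> nat) \<Rightarrow> 'a \<Rightarrow> 'a \<Rightarrow> 'a" where
  "parent T A \<phi> w =
     (if w = \<phi> then \<phi> else THE v. v \<in> neighbours T A w \<and> v \<in> set (geodesic T A \<phi> w))"

definition children :: "'a set \<Rightarrow> ('a \<Rightarrow> 'a \<Rightarrow> nat) \<Rightarrow> 'a \<Rightarrow> 'a \<Rightarrow> 'a set" where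
  "children T A \<phi> w = neighbours T A w - {parent T A \<phi> w}"

text \<open>The set \<open>\<Sigma>\<close> of infinite geodesic rays from the root; \<open>\<omega> n\<close> stands for \<open>[\<omega>]\<^sub>n\<close>.\<close>

definition rays :: "'a set \<Rightarrow> ('a \<Rightarrow> 'a \<Rightarrow> nat) \<Rightarrow> 'a \<Rightarrow> (nat \<Rightarrow> 'a) set" where
  "rays T A \<phi> =
     {\<omega>. range \<omega> \<subseteq> T \<and> \<omega> 0 = \<phi> \<and> (\<forall>n. map \<omega> [0..<Suc n] = geodesic T A \<phi> (\<omega> n))}"

text \<open>For distinct rays of a tree the set below is finite (they never meet again after separating) and contains 0.\<close>

definition ray_dist :: "(nat \<Rightarrow> 'a) \<Rightarrow> (nat \<Rightarrow> 'a) \<Rightarrow> real" where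
  "ray_dist \<omega> \<tau> = (if \<omega> = \<tau> then 0 else (1 / 2) ^ Max {m. \<omega> m = \<tau> m})"

section \<open>Partitions and the resolution\<close>

definition partition_of ::
    "'b topology \<Rightarrow> 'a set \<Rightarrow> ('a \<Rightarrow> 'a \<Rightarrow> nat) \<Rightarrow> 'a \<Rightarrow> ('a \<Rightarrow> 'b set) \<Rightarrow> bool" where
  "partition_of X T A \<phi> K \<longleftrightarrow>
     (\<forall>w\<in>T. K w \<noteq> {} \<and> compactin X (K w)) \<and>
     K \<phi> = topspace X \<and>
     (\<forall>w\<in>T. K w = (\<Union>v\<in>children T A \<phi> w. K v)) \<and>
     (\<forall>\<omega>\<in>rays T A \<phi>. \<exists>x. (\<Inter>m. K (\<omega> m)) = {x})"

definition ray_point :: "('a \<Rightarrow> 'b set) \<Rightarrow> (nat \<Rightarrow> 'a) \<Rightarrow> 'b" where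
  "ray_point K \<omega> = the_elem (\<Inter>m. K (\<omega> m))"

text \<open>Adjacency matrix of \<open>(T, \<B>)\<close>. The loops it contains do not affect distances.\<close>

definition resolution ::
    "'a set \<Rightarrow> ('a \<Rightarrow> 'a \<Rightarrow> nat) \<Rightarrow> 'a \<Rightarrow> ('a \<Rightarrow> 'b set) \<Rightarrow> 'a \<Rightarrow> 'a \<Rightarrow> nat" where
  "resolution T A \<phi> K w v =
     (if A w v = 1 \<or> (graph_dist T A \<phi> w = graph_dist T A \<phi> v \<and> K w \<inter> K v \<noteq> {}) then 1 else 0)"

definition ray_rel ::
    "'a set \<Rightarrow> ('a \<Rightarrow> 'a \<Rightarrow> nat) \<Rightarrow> 'a \<Rightarrow> ('a \<Rightarrow> 'b set) \<Rightarrow> ((nat \<Rightarrow> 'a) \<times> (nat \<Rightarrow> 'a)) set" where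
  "ray_rel T A \<phi> K =
     {(\<omega>, \<tau>). \<omega> \<in> rays T A \<phi> \<and> \<tau> \<in> rays T A \<phi> \<and>
        (SUP n\<in>{1..}. graph_dist T (resolution T A \<phi> K) (\<omega> n) (\<tau> n)) < \<infinity>}"

section \<open>Quotient topology\<close>

definition quotient_topology :: "'a topology \<Rightarrow> ('a \<times> 'a) set \<Rightarrow> 'a set topology" where
  "quotient_topology X r =
     topology (\<lambda>U. U \<subseteq> topspace X // r \<and> openin X {x \<in> topspace X. r `` {x} \<in> U})"

lemma openin_quotient_topology:
  "openin (quotient_topology X r) U \<longleftrightarrow>
     U \<subseteq> topspace X // r \<and> openin X {x \<in> topspace X. r `` {x} \<in> U}"
proof -
  have "istopology (\<lambda>U. U \<subseteq> topspace X // r \<and> openin X {x \<in> topspace X. r `` {x} \<in> U})"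
  proof (unfold istopology_def, intro conjI allI impI)
    fix S U
    assume S: "S \<subseteq> topspace X // r \<and> openin X {x \<in> topspace X. r `` {x} \<in> S}"
      and U: "U \<subseteq> topspace X // r \<and> openin X {x \<in> topspace X. r `` {x} \<in> U}"
    have "{x \<in> topspace X. r `` {x} \<in> S \<inter> U}
        = {x \<in> topspace X. r `` {x} \<in> S} \<inter> {x \<in> topspace X. r `` {x} \<in> U}" by blast
    also have "openin X \<dots>"
      using S U by (intro openin_Int) simp_all
    finally show "openin X {x \<in> topspace X. r `` {x} \<in> S \<inter> U}" .
    show "S \<inter> U \<subseteq> topspace X // r" using S by blast
  next
    fix \<U>
    assume *: "\<forall>U\<in>\<U>. U \<subseteq> topspace X // r \<and> openin X {x \<in> topspace X. r `` {x} \<in> U}"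
    have "{x \<in> topspace X. r `` {x} \<in> \<Union>\<U>} = (\<Union>U\<in>\<U>. {x \<in> topspace X. r `` {x} \<in> U})" by blast
    also have "openin X \<dots>"
      using * by (intro openin_Union) auto
    finally show "openin X {x \<in> topspace X. r `` {x} \<in> \<Union>\<U>}" .
    show "\<Union>\<U> \<subseteq> topspace X // r" using * by blast
  qed
  then show ?thesis
    by (simp add: quotient_topology_def)
qed

lemma topspace_quotient_topology: "topspace (quotient_topology X r) = topspace X // r"
proof -
  have "{x \<in> topspace X. r `` {x} \<in> topspace X // r} = topspace X"
    by (auto intro: quotientI)
  then have "openin (quotient_topology X r) (topspace X // r)"
    by (simp add: openin_quotient_topology)
  then show ?thesis
    by (meson openin_quotient_topology openin_subset openin_topspace subset_antisym)
qed

lemma quotient_map_quotient_topology: "quotient_map X (quotient_topology X r) (\<lambda>x. r `` {x})"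
  unfolding quotient_map_def topspace_quotient_topology
  by (auto simp: openin_quotient_topology quotient_def)

section \<open>The metric on rays\<close>

lemma rays_agree_below:
  assumes "\<omega> \<in> rays T A \<phi>" "\<tau> \<in> rays T A \<phi>" "\<omega> m = \<tau> m" "k \<le> m"
  shows "\<omega> k = \<tau> k"
proof -
  have "map \<omega> [0..<Suc m] = map \<tau> [0..<Suc m]"
    using assms unfolding rays_def mem_Collect_eq by metis
  then show ?thesis
    using \<open>k \<le> m\<close> by (auto simp: map_eq_conv simp del: upt_Suc)
qed

lemma ray_dist_le_iff:
  assumes "\<omega> \<in> rays T A \<phi>" "\<tau> \<in> rays T A \<phi>"
  shows "ray_dist \<omega> \<tau> \<le> (1 / 2) ^ n \<longleftrightarrow> \<omega> n = \<tau> n"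
proof (cases "\<omega> = \<tau>")
  case False
  then obtain j where j: "\<omega> j \<noteq> \<tau> j" by blast
  let ?S = "{m. \<omega> m = \<tau> m}"
  have "m < j" if "m \<in> ?S" for m
    using that j rays_agree_below[OF assms, of m j] by force
  then have fin: "finite ?S"
    by (meson finite_nat_iff_bounded lessThan_iff subsetI)
  have ne: "0 \<in> ?S" using assms by (simp add: rays_def)
  have "ray_dist \<omega> \<tau> \<le> (1 / 2) ^ n \<longleftrightarrow> n \<le> Max ?S"
    using False by (simp add: ray_dist_def power_decreasing_iff)
  also have "\<dots> \<longleftrightarrow> \<omega> n = \<tau> n"
    using Max_in[OF fin] Max_ge[OF fin] ne rays_agree_below[OF assms, of "Max ?S" n] by blast
  finally show ?thesis .
qed (simp add: ray_dist_def)

lemma Metric_space_rays: "Metric_space (rays T A \<phi>) ray_dist"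
proof
  show nonneg: "0 \<le> ray_dist \<omega> \<tau>" for \<omega> \<tau> :: "nat \<Rightarrow> 'a"
    by (simp add: ray_dist_def)
  show "ray_dist \<omega> \<tau> = ray_dist \<tau> \<omega>" for \<omega> \<tau> :: "nat \<Rightarrow> 'a"
    by (simp add: ray_dist_def eq_commute)
  show "(ray_dist \<omega> \<tau> = 0) = (\<omega> = \<tau>)" for \<omega> \<tau> :: "nat \<Rightarrow> 'a"
    by (simp add: ray_dist_def)
  fix \<omega> \<tau> \<upsilon>
  assume r: "\<omega> \<in> rays T A \<phi>" "\<tau> \<in> rays T A \<phi>" "\<upsilon> \<in> rays T A \<phi>"
  have "ray_dist \<omega> \<upsilon> \<le> max (ray_dist \<omega> \<tau>) (ray_dist \<tau> \<upsilon>)"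
  proof (cases "\<omega> = \<tau> \<or> \<tau> = \<upsilon>")
    case False
    then obtain i j where ij: "ray_dist \<omega> \<tau> = (1 / 2) ^ i" "ray_dist \<tau> \<upsilon> = (1 / 2) ^ j"
      by (auto simp: ray_dist_def)
    let ?n = "min i j"
    have m: "max (ray_dist \<omega> \<tau>) (ray_dist \<tau> \<upsilon>) = (1 / 2) ^ ?n"
      unfolding ij by (cases "i \<le> j") (simp_all add: max_def min_def)
    have "ray_dist \<omega> \<tau> \<le> (1 / 2) ^ ?n" "ray_dist \<tau> \<upsilon> \<le> (1 / 2) ^ ?n"
      unfolding m[symmetric] by simp_all
    then have "\<omega> ?n = \<upsilon> ?n"
      using ray_dist_le_iff[OF r(1,2), of ?n] ray_dist_le_iff[OF r(2,3), of ?n] by simp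
    then show ?thesis
      using ray_dist_le_iff[OF r(1,3), of ?n] m by simp
  qed (auto simp: max_def)
  then show "ray_dist \<omega> \<upsilon> \<le> ray_dist \<omega> \<tau> + ray_dist \<tau> \<upsilon>"
    using nonneg[of \<omega> \<tau>] nonneg[of \<tau> \<upsilon>] by linarith
qed

end

theory Submission
  imports Defs
begin

text \<open>If two rays have the same image \<open>x\<close> under \<open>\<sigma>\<close>, then at every level both of their cells contain
  \<open>x\<close>, so their vertices are at distance at most 1 in the resolution. Conversely, adjacent vertices
  of the resolution have intersecting cells and levels differing by at most 1. A path of length at
  most \<open>C\<close> between the \<open>n\<close>-th vertices of two rays is therefore a chain of at most \<open>C + 1\<close>
  intersecting cells of level at least \<open>n - C\<close>. The diameters of the cells tend to 0 uniformly in
  the level, by Koenig's lemma in the locally finite tree, so bounded distance forces equal images.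
  The same compactness argument makes \<open>\<sigma>\<close> a closed map; being also continuous and onto, it is a
  quotient map, and its fibres are the classes of the relation.\<close>

section \<open>Paths and distances in general graphs\<close>

lemma graph_path_singleton: "w \<in> T \<Longrightarrow> graph_path T A w [w] w"
  by (simp add: graph_path_def)

lemma graph_path_Cons:
  "p \<noteq> [] \<Longrightarrow> graph_path T A w (x # p) v \<longleftrightarrow>
     w = x \<and> x \<in> T \<and> A x (hd p) = 1 \<and> graph_path T A (hd p) p v"
  by (auto simp: graph_path_def successively_Cons)

lemma graph_path_snoc:
  "graph_path T A w p u \<Longrightarrow> v \<in> T \<Longrightarrow> A u v = 1 \<Longrightarrow> graph_path T A w (p @ [v]) v"
  by (auto simp: graph_path_def successively_append_iff)

lemma graph_path_prefix: "graph_path T A w (xs @ v # ys) u \<Longrightarrow> graph_path T A w (xs @ [v]) v"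
  by (auto simp: graph_path_def successively_append_iff hd_append split: if_splits)

text \<open>Cutting out the segment between two occurrences of a vertex leaves a strictly shorter
  path, so strong induction on the length applies. In a tree this makes the unique simple path a
  shortest one.\<close>

lemma distinct_subpath:
  assumes "graph_path T A w p v"
  shows "\<exists>q. graph_path T A w q v \<and> distinct q \<and> length q \<le> length p"
  using assms
proof (induction p rule: length_induct)
  case (1 p)
  show ?case
  proof (cases "distinct p")
    case False
    then obtain xs ys zs y where p: "p = xs @ [y] @ ys @ [y] @ zs"
      using not_distinct_decomp by blast
    have "graph_path T A w (xs @ [y] @ zs) v"
      using 1(2) unfolding p
      by (auto simp: graph_path_def successively_append_iff successively_Cons hd_append
          split: if_splits)
    moreover have "length (xs @ [y] @ zs) < length p" by (simp add: p)
    ultimately show ?thesis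
      using 1(1) by (meson less_imp_le_nat order_trans)
  qed (use 1 in blast)
qed

lemma graph_dist_le:
  "graph_path T A w p v \<Longrightarrow> graph_dist T A w v \<le> enat (length p - 1)"
  unfolding graph_dist_def by (rule INF_lower) simp

text \<open>A finite value rules out the empty set of paths, whose infimum is \<infinity>, and in
  the well-ordered type \<open>enat\<close> the infimum of a nonempty set is one of its
  elements.\<close>

lemma graph_dist_attained:
  assumes "graph_dist T A w v \<noteq> \<infinity>"
  obtains p where "graph_path T A w p v" "graph_dist T A w v = enat (length p - 1)"
proof -
  let ?S = "(\<lambda>p. enat (length p - 1)) ` {p. graph_path T A w p v}"
  have "?S \<noteq> {}"
  proof
    assume "?S = {}"
    then have "graph_dist T A w v = \<infinity>"
      by (simp only: graph_dist_def Inf_empty top_enat_def)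
    with assms show False ..
  qed
  then obtain k where "k \<in> ?S" by (meson ex_in_conv)
  then have "Inf ?S \<in> ?S" by (rule wellorder_InfI)
  then show thesis
    using that unfolding graph_dist_def by auto
qed

section \<open>Rooted trees: root paths, levels and children\<close>

locale rooted_tree =
  fixes T :: "'a set" and A :: "'a \<Rightarrow> 'a \<Rightarrow> nat" and \<phi> :: 'a
  assumes adjacency: "adjacency_matrix T A"
    and locally_finite: "locally_finite_graph T A"
    and tree: "tree_graph T A"
    and root: "\<phi> \<in> T"
begin

abbreviation root_path :: "'a \<Rightarrow> 'a list" where
  "root_path \<equiv> geodesic T A \<phi>"

text \<open>A natural number instead of an \<open>enat\<close>, convenient for arithmetic;
  \<open>graph_dist_root\<close> identifies it with the distance |w| from the root.\<close>

definition level :: "'a \<Rightarrow> nat" where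
  "level w = length (root_path w) - 1"

lemma adj_sym: "w \<in> T \<Longrightarrow> v \<in> T \<Longrightarrow> A w v = A v w"
  using adjacency by (auto simp: adjacency_matrix_def)

lemma adj_irrefl: "w \<in> T \<Longrightarrow> A w w = 0"
  using adjacency by (auto simp: adjacency_matrix_def)

lemma root_path:
  assumes "w \<in> T"
  shows "graph_path T A \<phi> (root_path w) w" "distinct (root_path w)"
proof -
  have "\<exists>!p. graph_path T A \<phi> p w \<and> distinct p"
    using tree root assms by (simp add: tree_graph_def)
  from theI'[OF this] show "graph_path T A \<phi> (root_path w) w" "distinct (root_path w)"
    by (simp_all add: geodesic_def)
qed

text \<open>The uniqueness of simple paths in a tree, in the form in which root paths are computed
  from here on.\<close>

lemma root_path_eqI:
  assumes "graph_path T A \<phi> p w" "distinct p"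
  shows "root_path w = p"
proof -
  have "w \<in> T"
    using assms by (auto simp: graph_path_def)
  then have "\<exists>!p. graph_path T A \<phi> p w \<and> distinct p"
    using tree root by (simp add: tree_graph_def)
  then show ?thesis
    using assms root_path[OF \<open>w \<in> T\<close>] by blast
qed

lemma root_path_ne: "w \<in> T \<Longrightarrow> root_path w \<noteq> []"
  and last_root_path: "w \<in> T \<Longrightarrow> last (root_path w) = w"
  and set_root_path: "w \<in> T \<Longrightarrow> set (root_path w) \<subseteq> T"
  and hd_root_path: "w \<in> T \<Longrightarrow> hd (root_path w) = \<phi>"
  using root_path(1)[of w] by (auto simp: graph_path_def)

lemma in_root_path: "w \<in> T \<Longrightarrow> w \<in> set (root_path w)"
  by (metis last_in_set last_root_path root_path_ne)

lemma length_root_path: "w \<in> T \<Longrightarrow> length (root_path w) = Suc (level w)"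
  using root_path_ne by (simp add: level_def)

lemma root_path_root: "root_path \<phi> = [\<phi>]"
  by (rule root_path_eqI) (simp_all add: graph_path_singleton root)

lemma graph_dist_root:
  assumes "w \<in> T"
  shows "graph_dist T A \<phi> w = enat (level w)"
proof (rule antisym)
  show "graph_dist T A \<phi> w \<le> enat (level w)"
    unfolding level_def by (rule graph_dist_le) (rule root_path[OF assms])
  show "enat (level w) \<le> graph_dist T A \<phi> w"
    unfolding graph_dist_def
  proof (rule INF_greatest)
    fix p assume "p \<in> {p. graph_path T A \<phi> p w}"
    then have "graph_path T A \<phi> p w" by simp
    from distinct_subpath[OF this]
    obtain q where q: "graph_path T A \<phi> q w" "distinct q" "length q \<le> length p"
      by (elim exE conjE)
    from root_path_eqI[OF q(1,2)] q(3) show "enat (level w) \<le> enat (length p - 1)"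
      by (simp add: level_def diff_le_mono)
  qed
qed

lemma root_path_prefix:
  assumes "v \<in> T" "root_path v = xs @ w # ys"
  shows "root_path w = xs @ [w]"
proof (rule root_path_eqI)
  show "graph_path T A \<phi> (xs @ [w]) w"
    using root_path(1)[OF assms(1)] graph_path_prefix unfolding assms(2) by metis
  show "distinct (xs @ [w])"
    using root_path(2)[OF assms(1)] unfolding assms(2) by auto
qed

lemma root_path_snoc:
  assumes "w \<in> T" "v \<in> T" "A w v = 1" "v \<notin> set (root_path w)"
  shows "root_path v = root_path w @ [v]"
  by (rule root_path_eqI) (use assms root_path[of w] graph_path_snoc in auto)

text \<open>If v is off the root path of w, that path extends by v. Otherwise cutting it at v gives
  the root path of v, which avoids w and so extends by w.\<close>

lemma root_path_adjacent:
  assumes "w \<in> T" "v \<in> T" "A w v = 1"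
  shows "root_path v = root_path w @ [v] \<or> root_path w = root_path v @ [w]"
proof (cases "v \<in> set (root_path w)")
  case True
  then obtain xs ys where xs: "root_path w = xs @ v # ys"
    by (meson split_list)
  have v: "root_path v = xs @ [v]"
    by (rule root_path_prefix[OF assms(1) xs])
  have "v \<noteq> w"
    using assms adj_irrefl by force
  \<comment> \<open>As w ends the whole path and differs from v, it lies in \<open>ys\<close>;
    distinctness then keeps it out of the initial segment ending at v.\<close>
  then have "ys \<noteq> []" "last ys = w"
    using last_root_path[OF assms(1)] xs by (auto split: if_splits)
  then have "w \<notin> set (root_path v)"
    using root_path(2)[OF assms(1)] last_in_set[of ys] unfolding xs v by auto
  then show ?thesis
    using root_path_snoc[of v w] assms adj_sym by auto
qed (use root_path_snoc assms in blast)

lemma parent_eqI: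
  assumes "w \<in> T" "v \<in> T" "A w v = 1" "root_path w = root_path v @ [w]"
  shows "parent T A \<phi> w = v"
proof -
  have "w \<noteq> \<phi>"
    using assms root_path_root root_path_ne by auto
  moreover have "(THE u. u \<in> neighbours T A w \<and> u \<in> set (root_path w)) = v"
  proof (rule the_equality)
    show "v \<in> neighbours T A w \<and> v \<in> set (root_path w)"
      using assms in_root_path by (simp add: neighbours_def)
    fix u assume u: "u \<in> neighbours T A w \<and> u \<in> set (root_path w)"
    then have "u \<in> T" "A w u = 1" by (auto simp: neighbours_def)
    moreover have "root_path u \<noteq> root_path w @ [u]"
      using u root_path(2)[OF \<open>u \<in> T\<close>] by auto
    ultimately have "root_path w = root_path u @ [w]"
      using root_path_adjacent assms(1) by blast
    then show "u = v"
      using assms(4) last_root_path \<open>u \<in> T\<close> \<open>v \<in> T\<close> by (metis append_same_eq)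
  qed
  ultimately show ?thesis by (simp add: parent_def)
qed

text \<open>This separates the parent from the children, since a child of w never lies on the root
  path of w. It covers the root too, which is its own parent by convention.\<close>

lemma parent_in_root_path:
  assumes "w \<in> T"
  shows "parent T A \<phi> w \<in> set (root_path w)"
proof (cases "w = \<phi>")
  case True
  then show ?thesis by (simp add: parent_def root_path_root)
next
  case False
  obtain xs where xs: "root_path w = xs @ [w]"
    by (metis append_butlast_last_id assms last_root_path root_path_ne)
  have "xs \<noteq> []"
    using hd_root_path[OF assms] xs False by auto
  then obtain ys v where "xs = ys @ [v]"
    by (metis rev_exhaust)
  then have e: "root_path w = ys @ v # [w]" using xs by simp
  have v: "v \<in> T" using set_root_path[OF assms] e by auto
  have "A v w = 1"
    using root_path(1)[OF assms] unfolding e by (auto simp: graph_path_def successively_append_iff)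
  then have "parent T A \<phi> w = v"
    using parent_eqI[OF assms v] adj_sym[OF assms v] root_path_prefix[OF assms e] e by simp
  then show ?thesis using e by simp
qed

text \<open>Replaces the definition by exclusion of the parent: of the two alternatives for adjacent
  vertices, the one that shortens the root path would make v the parent of w.\<close>

lemma children_iff:
  assumes "w \<in> T"
  shows "v \<in> children T A \<phi> w \<longleftrightarrow> v \<in> T \<and> A w v = 1 \<and> root_path v = root_path w @ [v]"
proof
  assume v: "v \<in> children T A \<phi> w"
  then have "v \<in> T" "A w v = 1" "parent T A \<phi> w \<noteq> v"
    by (auto simp: children_def neighbours_def)
  then show "v \<in> T \<and> A w v = 1 \<and> root_path v = root_path w @ [v]"
    using root_path_adjacent parent_eqI assms by blast
next
  assume v: "v \<in> T \<and> A w v = 1 \<and> root_path v = root_path w @ [v]"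
  then have "v \<notin> set (root_path w)"
    using root_path(2)[of v] by auto
  then show "v \<in> children T A \<phi> w"
    using v parent_in_root_path[OF assms] by (auto simp: children_def neighbours_def)
qed

lemma children_in: "v \<in> children T A \<phi> w \<Longrightarrow> v \<in> T"
  by (auto simp: children_def neighbours_def)

lemma level_child: "w \<in> T \<Longrightarrow> v \<in> children T A \<phi> w \<Longrightarrow> level v = Suc (level w)"
  by (simp add: children_iff level_def root_path_ne Suc_diff_1)

lemma finite_children: "w \<in> T \<Longrightarrow> finite (children T A \<phi> w)"
  using locally_finite by (simp add: locally_finite_graph_def children_def)

lemma adjacent_cases:
  assumes "w \<in> T" "v \<in> T" "A w v = 1"
  shows "v \<in> children T A \<phi> w \<or> w \<in> children T A \<phi> v"
  using root_path_adjacent[OF assms] assms adj_sym by (auto simp: children_iff)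

lemma root_path_consecutive:
  assumes "v \<in> T" "root_path v = xs @ w # u # ys"
  shows "u \<in> children T A \<phi> w"
proof -
  have wu: "w \<in> T" "u \<in> T" using set_root_path[OF assms(1)] assms(2) by auto
  have "A w u = 1"
    using root_path(1)[OF assms(1)] unfolding assms(2)
    by (auto simp: graph_path_def successively_append_iff)
  moreover have "root_path u = (xs @ [w]) @ [u]"
    by (rule root_path_prefix[of v _ _ ys]) (use assms in auto)
  moreover have "root_path w = xs @ [w]"
    by (rule root_path_prefix[OF assms])
  ultimately show ?thesis using wu by (simp add: children_iff)
qed

text \<open>By local finiteness and induction: every vertex of level n + 1 is a child of one of the
  finitely many vertices of level n.\<close>

lemma finite_level: "finite {w \<in> T. level w = n}"
proof (induction n)
  case 0
  have "w = \<phi>" if "w \<in> T" "level w = 0" for w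
    using length_root_path[OF that(1)] that hd_root_path[OF that(1)] last_root_path[OF that(1)]
    by (auto simp: length_Suc_conv)
  then have "{w \<in> T. level w = 0} \<subseteq> {\<phi>}" by blast
  then show ?case by (rule finite_subset) simp
next
  case (Suc n)
  have "{w \<in> T. level w = Suc n} \<subseteq> (\<Union>v\<in>{w \<in> T. level w = n}. children T A \<phi> v)"
  proof
    fix w assume "w \<in> {w \<in> T. level w = Suc n}"
    then have w: "w \<in> T" "length (root_path w) = Suc (Suc n)"
      using length_root_path by auto
    obtain xs where xs: "root_path w = xs @ [w]"
      by (metis append_butlast_last_id last_root_path root_path_ne w(1))
    with w(2) have "xs \<noteq> []" by auto
    then obtain ys v where "xs = ys @ [v]"
      by (metis rev_exhaust)
    then have e: "root_path w = ys @ v # w # []" using xs by simp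
    then have "v \<in> T" using set_root_path[OF w(1)] by auto
    moreover have c: "w \<in> children T A \<phi> v"
      using root_path_consecutive[OF w(1) e] .
    ultimately show "w \<in> (\<Union>v\<in>{w \<in> T. level w = n}. children T A \<phi> v)"
      using level_child[of v w] w length_root_path[of w] by auto
  qed
  then show ?case
    by (rule finite_subset) (use Suc finite_children in auto)
qed

section \<open>Rays from the root and the fan theorem\<close>

lemma rays_iff: "\<omega> \<in> rays T A \<phi> \<longleftrightarrow> \<omega> 0 = \<phi> \<and> (\<forall>n. \<omega> (Suc n) \<in> children T A \<phi> (\<omega> n))"
proof
  assume "\<omega> \<in> rays T A \<phi>"
  then have w: "\<And>n. \<omega> n \<in> T" "\<omega> 0 = \<phi>" "\<And>n. root_path (\<omega> n) = map \<omega> [0..<Suc n]"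
    by (auto simp: rays_def simp del: upt_Suc)
  have "\<omega> (Suc n) \<in> children T A \<phi> (\<omega> n)" for n
    by (rule root_path_consecutive[of "\<omega> (Suc n)" "map \<omega> [0..<n]" _ _ "[]"])
      (use w in \<open>simp_all\<close>)
  then show "\<omega> 0 = \<phi> \<and> (\<forall>n. \<omega> (Suc n) \<in> children T A \<phi> (\<omega> n))"
    using w by blast
next
  assume w: "\<omega> 0 = \<phi> \<and> (\<forall>n. \<omega> (Suc n) \<in> children T A \<phi> (\<omega> n))"
  have wT: "\<omega> n \<in> T" for n
    by (cases n) (use w root children_in in auto)
  have "root_path (\<omega> n) = map \<omega> [0..<Suc n]" for n
  proof (induction n)
    case 0
    then show ?case using w by (simp add: root_path_root)
  next
    case (Suc n)
    then show ?case using w wT children_iff[of "\<omega> n" "\<omega> (Suc n)"] by simp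
  qed
  then show "\<omega> \<in> rays T A \<phi>"
    using w wT unfolding rays_def by auto
qed

lemma ray_in: "\<omega> \<in> rays T A \<phi> \<Longrightarrow> \<omega> n \<in> T"
  by (auto simp: rays_def)

lemma root_path_ray: "\<omega> \<in> rays T A \<phi> \<Longrightarrow> root_path (\<omega> n) = map \<omega> [0..<Suc n]"
  by (simp add: rays_def del: upt_Suc)

lemma level_ray: "\<omega> \<in> rays T A \<phi> \<Longrightarrow> level (\<omega> n) = n"
  by (simp add: level_def root_path_ray del: upt_Suc)

text \<open>Dependent choice: a property inherited by some child at every vertex can be followed
  downwards forever.\<close>

lemma ray_exists:
  assumes "P \<phi>" "\<And>w. w \<in> T \<Longrightarrow> P w \<Longrightarrow> \<exists>v\<in>children T A \<phi> w. P v"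
  obtains \<omega> where "\<omega> \<in> rays T A \<phi>" "\<And>n. P (\<omega> n)"
proof -
  have "\<exists>\<omega>. \<forall>n. (\<omega> n \<in> T \<and> P (\<omega> n) \<and> (n = 0 \<longrightarrow> \<omega> n = \<phi>)) \<and> \<omega> (Suc n) \<in> children T A \<phi> (\<omega> n)"
  proof (rule dependent_nat_choice)
    show "\<exists>w. w \<in> T \<and> P w \<and> (0 = (0::nat) \<longrightarrow> w = \<phi>)"
      using assms(1) root by blast
    fix w and n :: nat assume "w \<in> T \<and> P w \<and> (n = 0 \<longrightarrow> w = \<phi>)"
    then show "\<exists>v. (v \<in> T \<and> P v \<and> (Suc n = 0 \<longrightarrow> v = \<phi>)) \<and> v \<in> children T A \<phi> w"
      using assms(2) children_in by blast
  qed
  then show thesis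
    using that unfolding rays_iff by blast
qed

text \<open>The fan theorem: this is how compactness of the space of rays enters.\<close>

lemma fan:
  assumes "\<And>\<omega>. \<omega> \<in> rays T A \<phi> \<Longrightarrow> \<exists>n. P (\<omega> n)"
  obtains N where "\<And>v. v \<in> T \<Longrightarrow> N \<le> level v \<Longrightarrow> \<exists>u\<in>set (root_path v). P u"
proof -
  \<comment> \<open>\<open>Q w N\<close> localizes the conclusion to the subtree below w. If no N
    works at the root, then failure descends to some child at each vertex, hence along an entire
    ray.\<close>
  define Q where "Q w N \<longleftrightarrow> (\<forall>v\<in>T. w \<in> set (root_path v) \<longrightarrow> N \<le> level v \<longrightarrow>
    (\<exists>u\<in>set (root_path v). P u))" for w N
  have mono: "Q w N \<Longrightarrow> N \<le> N' \<Longrightarrow> Q w N'" for w N N'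
    unfolding Q_def by (meson order_trans)
  have "\<exists>N. Q \<phi> N"
  proof (rule ccontr)
    assume *: "\<not> (\<exists>N. Q \<phi> N)"
    have step: "\<exists>v\<in>children T A \<phi> w. \<not> (\<exists>N. Q v N)" if w: "w \<in> T" "\<not> (\<exists>N. Q w N)" for w
    proof (rule ccontr)
      assume "\<not> ?thesis"
      then obtain f where f: "\<And>v. v \<in> children T A \<phi> w \<Longrightarrow> Q v (f v)" by metis
      \<comment> \<open>The maximum of the finitely many bounds of the children serves for w.
        Including \<open>Suc (level w)\<close> forces v strictly below w, so its root path runs
        through a child of w.\<close>
      define N where "N = Max (insert (Suc (level w)) (f ` children T A \<phi> w))"
      have fin: "finite (insert (Suc (level w)) (f ` children T A \<phi> w))"
        using finite_children w by simp
      have "Q w N"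
        unfolding Q_def
      proof (intro ballI impI)
        fix v assume v: "v \<in> T" "w \<in> set (root_path v)" "N \<le> level v"
        have "Suc (level w) \<le> N" unfolding N_def by (rule Max_ge[OF fin]) simp
        with v have "v \<noteq> w" by auto
        obtain xs zs where e: "root_path v = xs @ w # zs" using v(2) by (meson split_list)
        have "zs \<noteq> []" using last_root_path[OF v(1)] e \<open>v \<noteq> w\<close> by auto
        then obtain c ys where zs: "zs = c # ys" by (meson list.exhaust)
        have c: "c \<in> children T A \<phi> w"
          by (rule root_path_consecutive[OF v(1)]) (use e zs in simp)
        have "f c \<le> N" unfolding N_def by (rule Max_ge[OF fin]) (use c in simp)
        then have "Q c N" using f[OF c] mono by blast
        moreover have "c \<in> set (root_path v)" by (simp add: e zs)
        ultimately show "\<exists>u\<in>set (root_path v). P u"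
          using v unfolding Q_def by blast
      qed
      with w show False by blast
    qed
    obtain \<omega> where \<omega>: "\<omega> \<in> rays T A \<phi>" "\<And>n. \<not> (\<exists>N. Q (\<omega> n) N)"
      using ray_exists[of "\<lambda>w. \<not> (\<exists>N. Q w N)", OF * step] by blast
    obtain n where "P (\<omega> n)" using assms \<omega>(1) by blast
    \<comment> \<open>The root path of every vertex below \<omega> n contains \<omega> n itself, so
      the bound 0 works there.\<close>
    then have "Q (\<omega> n) 0" by (auto simp: Q_def)
    with \<omega>(2) show False by blast
  qed
  then obtain N where "Q \<phi> N" by blast
  moreover have "\<phi> \<in> set (root_path v)" if "v \<in> T" for v
    using hd_root_path[OF that] root_path_ne[OF that] by (metis hd_in_set)
  ultimately show thesis
    using that unfolding Q_def by blast
qed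

end

section \<open>Cells of a partition and the map \<sigma>\<close>

locale tree_partition = rooted_tree T A \<phi>
  for T :: "'a set" and A :: "'a \<Rightarrow> 'a \<Rightarrow> nat" and \<phi> :: 'a +
  fixes X :: "'b topology" and K :: "'a \<Rightarrow> 'b set"
  assumes compact: "compact_space X"
    and metrizable: "metrizable_space X"
    and partition: "partition_of X T A \<phi> K"
begin

abbreviation ray_topology :: "(nat \<Rightarrow> 'a) topology" where
  "ray_topology \<equiv> Metric_space.mtopology (rays T A \<phi>) ray_dist"

lemma K_ne: "w \<in> T \<Longrightarrow> K w \<noteq> {}"
  and K_compact: "w \<in> T \<Longrightarrow> compactin X (K w)"
  and K_root: "K \<phi> = topspace X"
  and K_children: "w \<in> T \<Longrightarrow> K w = (\<Union>v\<in>children T A \<phi> w. K v)"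
  and K_ray: "\<omega> \<in> rays T A \<phi> \<Longrightarrow> \<exists>x. (\<Inter>m. K (\<omega> m)) = {x}"
  using partition unfolding partition_of_def by blast+

lemma Hausdorff: "Hausdorff_space X"
  using metrizable by (rule metrizable_imp_Hausdorff_space)

lemma K_closed: "w \<in> T \<Longrightarrow> closedin X (K w)"
  using K_compact Hausdorff compactin_imp_closedin by blast

lemma K_child_subset: "w \<in> T \<Longrightarrow> v \<in> children T A \<phi> w \<Longrightarrow> K v \<subseteq> K w"
  using K_children by blast

text \<open>Cells shrink from parent to child; the induction removes vertices from the far end of
  the path segment that leads from w to v.\<close>

lemma K_root_path_mono:
  assumes "v \<in> T" "w \<in> set (root_path v)"
  shows "K v \<subseteq> K w"
proof -
  have "K v \<subseteq> K w" if "root_path v = xs @ w # ys" "v \<in> T" for xs ys v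
    using that
  proof (induction ys arbitrary: v rule: rev_induct)
    case Nil
    then show ?case using last_root_path[of v] by simp
  next
    case (snoc u ys)
    have "u = v" using last_root_path[of v] snoc(2,3) by simp
    \<comment> \<open>The predecessor of v on its root path, to which the induction hypothesis
      applies.\<close>
    define b where "b = last (w # ys)"
    define zs where "zs = butlast (w # ys)"
    have wys: "w # ys = zs @ [b]" by (simp add: b_def zs_def del: last.simps butlast.simps)
    have v: "root_path v = (xs @ zs) @ b # v # []"
      using snoc(2) \<open>u = v\<close> wys by (metis append.assoc append_Cons append_Nil)
    have "b \<in> T" using v set_root_path[OF snoc(3)] by auto
    have "root_path b = xs @ w # ys"
      using root_path_prefix[OF snoc(3) v] wys by simp
    then have "K b \<subseteq> K w" using \<open>b \<in> T\<close> by (rule snoc(1))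
    moreover have "K v \<subseteq> K b"
      using K_child_subset[OF \<open>b \<in> T\<close>] root_path_consecutive[OF snoc(3) v] by blast
    ultimately show ?case by blast
  qed
  then show ?thesis using assms by (meson split_list)
qed

lemma K_ray_antimono:
  assumes "\<omega> \<in> rays T A \<phi>" "m \<le> n"
  shows "K (\<omega> n) \<subseteq> K (\<omega> m)"
proof (rule K_root_path_mono)
  show "\<omega> n \<in> T" using assms(1) by (rule ray_in)
  show "\<omega> m \<in> set (root_path (\<omega> n))"
    unfolding root_path_ray[OF assms(1)] using assms(2) by (simp del: upt_Suc)
qed

lemma Inter_K_ray:
  assumes "\<omega> \<in> rays T A \<phi>"
  shows "(\<Inter>m. K (\<omega> m)) = {ray_point K \<omega>}"
proof -
  obtain x where "(\<Inter>m. K (\<omega> m)) = {x}" using K_ray[OF assms] by (elim exE)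
  then show ?thesis by (simp only: ray_point_def the_elem_eq)
qed

lemma ray_point_in: "\<omega> \<in> rays T A \<phi> \<Longrightarrow> ray_point K \<omega> \<in> K (\<omega> n)"
  using INT_D[of "ray_point K \<omega>" "\<lambda>m. K (\<omega> m)" UNIV n] by (simp add: Inter_K_ray)

lemma ray_point_eqI:
  assumes "\<omega> \<in> rays T A \<phi>" "\<And>n. x \<in> K (\<omega> n)"
  shows "ray_point K \<omega> = x"
proof -
  have "x \<in> (\<Inter>m. K (\<omega> m))" using assms(2) by (rule INT_I)
  then show ?thesis by (simp add: Inter_K_ray[OF assms(1)])
qed

lemma ray_point_topspace: "\<omega> \<in> rays T A \<phi> \<Longrightarrow> ray_point K \<omega> \<in> topspace X"
  using ray_point_in[of \<omega> 0] K_root rays_iff[of \<omega>] by simp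

text \<open>Since the cells of the children cover a cell, one can always descend to a child whose
  cell still contains x.\<close>

lemma ray_point_surj:
  assumes "x \<in> topspace X"
  obtains \<omega> where "\<omega> \<in> rays T A \<phi>" "ray_point K \<omega> = x"
proof (rule ray_exists[of "\<lambda>w. x \<in> K w"])
  show "x \<in> K \<phi>" using assms K_root by simp
  show "\<exists>v\<in>children T A \<phi> w. x \<in> K v" if "w \<in> T" "x \<in> K w" for w
    using that K_children[of w] by blast
qed (use that ray_point_eqI in blast)

text \<open>If no cell of the ray fitted into U, the sets left after removing U would be nested,
  closed and nonempty, so by compactness they would share a point. But \<sigma>(\<omega>) is the
  only point common to all the cells, and it lies in U.\<close>

lemma K_ray_shrinks:
  assumes "\<omega> \<in> rays T A \<phi>" "openin X U" "ray_point K \<omega> \<in> U"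
  obtains n where "K (\<omega> n) \<subseteq> U"
proof (rule ccontr)
  assume "\<not> thesis"
  then have ne: "K (\<omega> n) - U \<noteq> {}" for n using that by auto
  have "(\<Inter>n. K (\<omega> n) - U) \<noteq> {}"
  proof (rule compact_space_imp_nest[OF compact])
    show "closedin X (K (\<omega> n) - U)" for n
      by (intro closedin_diff K_closed ray_in assms)
    show "decseq (\<lambda>n. K (\<omega> n) - U)"
      using K_ray_antimono[OF assms(1)] unfolding decseq_def by blast
  qed (use ne in auto)
  then show False
    using Inter_K_ray[OF assms(1)] assms(3) by blast
qed

section \<open>The topology of the ray space; \<sigma> as a quotient map\<close>

lemma topspace_ray_topology: "topspace ray_topology = rays T A \<phi>"
  using Metric_space.topspace_mtopology[OF Metric_space_rays] .

text \<open>Closed balls of radius 2^-n are the cylinders of rays sharing their n-th vertex, so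
  these cylinders form a base and the metric can be forgotten afterwards.\<close>

lemma openin_ray_topology:
  "openin ray_topology U \<longleftrightarrow> U \<subseteq> rays T A \<phi> \<and>
     (\<forall>\<omega>\<in>U. \<exists>n. \<forall>\<tau>\<in>rays T A \<phi>. \<tau> n = \<omega> n \<longrightarrow> \<tau> \<in> U)"
proof -
  interpret M: Metric_space "rays T A \<phi>" ray_dist by (rule Metric_space_rays)
  have "(\<exists>r>0. M.mball \<omega> r \<subseteq> U) \<longleftrightarrow> (\<exists>n. \<forall>\<tau>\<in>rays T A \<phi>. \<tau> n = \<omega> n \<longrightarrow> \<tau> \<in> U)"
    if \<omega>: "\<omega> \<in> rays T A \<phi>" for \<omega>
  proof
    assume "\<exists>r>0. M.mball \<omega> r \<subseteq> U"
    then obtain r where r: "r > 0" "M.mball \<omega> r \<subseteq> U" by blast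
    obtain n where n: "(1/2 :: real) ^ n < r"
      using real_arch_pow_inv[OF r(1), of "1/2"] by auto
    have "\<tau> \<in> U" if "\<tau> \<in> rays T A \<phi>" "\<tau> n = \<omega> n" for \<tau>
      using ray_dist_le_iff[OF \<omega> that(1), of n] that n r(2) \<omega> by (auto simp: M.in_mball)
    then show "\<exists>n. \<forall>\<tau>\<in>rays T A \<phi>. \<tau> n = \<omega> n \<longrightarrow> \<tau> \<in> U" by blast
  next
    assume "\<exists>n. \<forall>\<tau>\<in>rays T A \<phi>. \<tau> n = \<omega> n \<longrightarrow> \<tau> \<in> U"
    then obtain n where n: "\<And>\<tau>. \<tau> \<in> rays T A \<phi> \<Longrightarrow> \<tau> n = \<omega> n \<Longrightarrow> \<tau> \<in> U" by blast
    have "M.mball \<omega> ((1/2) ^ n) \<subseteq> U"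
      using n ray_dist_le_iff[OF \<omega>, of _ n] by (force simp: M.in_mball)
    then show "\<exists>r>0. M.mball \<omega> r \<subseteq> U"
      by (intro exI[of _ "(1/2) ^ n"]) simp
  qed
  then show ?thesis unfolding M.openin_mtopology by blast
qed

lemma continuous_map_ray_point: "continuous_map ray_topology X (ray_point K)"
  unfolding continuous_map
proof (intro conjI allI impI)
  show "ray_point K ` topspace ray_topology \<subseteq> topspace X"
    using ray_point_topspace by (auto simp: topspace_ray_topology)
  fix U assume U: "openin X U"
  show "openin ray_topology {\<omega> \<in> topspace ray_topology. ray_point K \<omega> \<in> U}"
    unfolding openin_ray_topology topspace_ray_topology
  proof (intro conjI ballI)
    fix \<omega> assume "\<omega> \<in> {\<omega> \<in> rays T A \<phi>. ray_point K \<omega> \<in> U}"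
    then obtain n where n: "K (\<omega> n) \<subseteq> U"
      using K_ray_shrinks U by blast
    then show "\<exists>n. \<forall>\<tau>\<in>rays T A \<phi>. \<tau> n = \<omega> n \<longrightarrow> \<tau> \<in> {\<omega> \<in> rays T A \<phi>. ray_point K \<omega> \<in> U}"
      using ray_point_in by (intro exI[of _ n]) (metis (mono_tags, lifting) mem_Collect_eq subsetD)
  qed blast
qed

text \<open>For x outside the image of C, the fan theorem yields one level N at which the cells of
  all rays in C miss x. Finitely many closed cells then cover the image without containing
  x.\<close>

lemma closed_map_ray_point: "closed_map ray_topology X (ray_point K)"
  unfolding closed_map_def
proof (intro allI impI)
  fix C assume "closedin ray_topology C"
  then have C: "C \<subseteq> rays T A \<phi>" "openin ray_topology (rays T A \<phi> - C)"
    by (auto simp: closedin_def topspace_ray_topology)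
  have "\<exists>V. openin X V \<and> x \<in> V \<and> V \<subseteq> topspace X - ray_point K ` C"
    if x: "x \<in> topspace X - ray_point K ` C" for x
  proof -
    \<comment> \<open>A ray can visit w only at index \<open>level w\<close>, so the first
      alternative says that no ray of C passes through w. It occurs on rays outside C, as C is
      closed; rays in C reach the second, as they do not map to x.\<close>
    define P where "P w \<longleftrightarrow> (\<forall>\<tau>\<in>C. w \<noteq> \<tau> (level w)) \<or> x \<notin> K w" for w
    have "\<exists>n. P (\<omega> n)" if \<omega>: "\<omega> \<in> rays T A \<phi>" for \<omega>
    proof (cases "\<omega> \<in> C")
      case True
      then have "ray_point K \<omega> \<noteq> x" using x by blast
      then show ?thesis using ray_point_eqI[OF \<omega>] unfolding P_def by blast
    next
      case False
      then have "\<exists>n. \<forall>\<tau>\<in>rays T A \<phi>. \<tau> n = \<omega> n \<longrightarrow> \<tau> \<in> rays T A \<phi> - C"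
        using C(2) \<omega> unfolding openin_ray_topology by blast
      then show ?thesis
        using C(1) level_ray[OF \<omega>] unfolding P_def by (metis DiffD2 subsetD)
    qed
    then obtain N where N: "\<And>v. v \<in> T \<Longrightarrow> N \<le> level v \<Longrightarrow> \<exists>u\<in>set (root_path v). P u"
      using fan by blast
    define F where "F = (\<Union>w\<in>{w \<in> T. level w = N \<and> x \<notin> K w}. K w)"
    have "finite {w \<in> T. level w = N \<and> x \<notin> K w}"
      by (rule finite_subset[OF _ finite_level[of N]]) blast
    then have "closedin X F"
      unfolding F_def by (intro closedin_Union finite_imageI) (auto intro: K_closed)
    then have "openin X (topspace X - F)" by blast
    moreover have "x \<in> topspace X - F" using x by (auto simp: F_def)
    moreover have "ray_point K \<tau> \<in> F" if "\<tau> \<in> C" for \<tau>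
    proof -
      have \<tau>: "\<tau> \<in> rays T A \<phi>" using that C(1) by blast
      obtain u where u: "u \<in> set (root_path (\<tau> N))" "P u"
        using N[of "\<tau> N"] ray_in[OF \<tau>] level_ray[OF \<tau>] by auto
      then obtain k where k: "u = \<tau> k" "k \<le> N"
        unfolding root_path_ray[OF \<tau>] by (auto simp: less_Suc_eq_le simp del: upt_Suc)
      \<comment> \<open>The ray \<tau> of C passes through this vertex, which excludes the first
        alternative of \<open>P\<close>.\<close>
      then have "x \<notin> K (\<tau> k)"
        using u(2) that level_ray[OF \<tau>] unfolding P_def by auto
      then have "x \<notin> K (\<tau> N)" using K_ray_antimono[OF \<tau> k(2)] by blast
      then show ?thesis
        unfolding F_def using ray_point_in[OF \<tau>] ray_in[OF \<tau>] level_ray[OF \<tau>] by auto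
    qed
    ultimately show ?thesis by blast
  qed
  then have "openin X (topspace X - ray_point K ` C)"
    by (subst openin_subopen) (rule ballI)
  then show "closedin X (ray_point K ` C)"
    unfolding closedin_def using C(1) ray_point_topspace by blast
qed

lemma quotient_map_ray_point: "quotient_map ray_topology X (ray_point K)"
proof (rule continuous_closed_imp_quotient_map
    [OF continuous_map_ray_point closed_map_ray_point])
  show "ray_point K ` topspace ray_topology = topspace X"
    using ray_point_surj ray_point_topspace unfolding topspace_ray_topology by blast
qed

section \<open>Bounded distance in the resolution and equality under \<sigma>\<close>

lemma resolution_adjacent:
  assumes "w \<in> T" "v \<in> T" "resolution T A \<phi> K w v = 1"
  shows "level w \<le> Suc (level v)" "K w \<inter> K v \<noteq> {}"
proof -
  have "A w v = 1 \<or> level w = level v \<and> K w \<inter> K v \<noteq> {}"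
  proof (rule ccontr)
    assume "\<not> ?thesis"
    then have "resolution T A \<phi> K w v = 0"
      by (simp add: resolution_def graph_dist_root[OF assms(1)] graph_dist_root[OF assms(2)])
    with assms(3) show False by simp
  qed
  then consider "A w v = 1" | "level w = level v" "K w \<inter> K v \<noteq> {}" by blast
  then have "level w \<le> Suc (level v) \<and> K w \<inter> K v \<noteq> {}"
  proof cases
    case 1
    \<comment> \<open>Along a tree edge one cell contains the other, and the smaller one is
      nonempty.\<close>
    then consider "v \<in> children T A \<phi> w" | "w \<in> children T A \<phi> v"
      using adjacent_cases[OF assms(1,2)] by blast
    then show ?thesis
    proof cases
      case 1
      then show ?thesis
        using level_child[OF assms(1)] K_child_subset[OF assms(1)] K_ne[OF assms(2)] by fastforce
    next
      case 2
      then show ?thesis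
        using level_child[OF assms(2)] K_child_subset[OF assms(2)] K_ne[OF assms(1)] by fastforce
    qed
  qed simp
  then show "level w \<le> Suc (level v)" "K w \<inter> K v \<noteq> {}" by auto
qed

text \<open>The common image lies in both cells, which gives a horizontal edge. If the two vertices
  coincide, the path of two entries runs along a loop of \<open>resolution\<close>.\<close>

lemma graph_dist_resolution_le_1:
  assumes "\<omega> \<in> rays T A \<phi>" "\<tau> \<in> rays T A \<phi>" "ray_point K \<omega> = ray_point K \<tau>"
  shows "graph_dist T (resolution T A \<phi> K) (\<omega> n) (\<tau> n) \<le> 1"
proof -
  have "K (\<omega> n) \<inter> K (\<tau> n) \<noteq> {}"
    using ray_point_in[OF assms(1)] ray_point_in[OF assms(2)] assms(3) by auto
  then have "graph_path T (resolution T A \<phi> K) (\<omega> n) [\<omega> n, \<tau> n] (\<tau> n)"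
    using ray_in[OF assms(1)] ray_in[OF assms(2)]
    by (simp add: graph_path_def resolution_def graph_dist_root
        level_ray[OF assms(1)] level_ray[OF assms(2)])
  from graph_dist_le[OF this] show ?thesis by (simp add: one_enat_def)
qed

text \<open>On each ray some cell fits into a ball of radius \<epsilon>/2 around the image of the
  ray; the fan theorem makes the level uniform, and deeper cells are smaller still.\<close>

lemma K_uniformly_small:
  fixes d :: "'b \<Rightarrow> 'b \<Rightarrow> real"
  assumes "Metric_space M d" "X = Metric_space.mtopology M d" "\<epsilon> > 0"
  obtains N where "\<And>v x y. v \<in> T \<Longrightarrow> N \<le> level v \<Longrightarrow> x \<in> K v \<Longrightarrow> y \<in> K v \<Longrightarrow> d x y < \<epsilon>"
proof -
  interpret M: Metric_space M d by fact
  define P where "P w \<longleftrightarrow> (\<forall>x\<in>K w. \<forall>y\<in>K w. d x y < \<epsilon>)" for w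
  have "\<exists>n. P (\<omega> n)" if \<omega>: "\<omega> \<in> rays T A \<phi>" for \<omega>
  proof -
    let ?p = "ray_point K \<omega>"
    have "?p \<in> M.mball ?p (\<epsilon> / 2)"
      using ray_point_topspace[OF \<omega>] assms by simp
    then obtain n where n: "K (\<omega> n) \<subseteq> M.mball ?p (\<epsilon> / 2)"
      using K_ray_shrinks[OF \<omega>] assms(2) M.openin_mball by metis
    have "d x y < \<epsilon>" if "x \<in> K (\<omega> n)" "y \<in> K (\<omega> n)" for x y
    proof -
      have "x \<in> M" "y \<in> M" "?p \<in> M" "d ?p x < \<epsilon> / 2" "d ?p y < \<epsilon> / 2"
        using n that by (auto simp: M.in_mball)
      then show ?thesis
        using M.triangle[of x ?p y] M.commute[of x ?p] by linarith
    qed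
    then show ?thesis unfolding P_def by blast
  qed
  then obtain N where "\<And>v. v \<in> T \<Longrightarrow> N \<le> level v \<Longrightarrow> \<exists>u\<in>set (root_path v). P u"
    using fan by blast
  then show thesis
    using that K_root_path_mono unfolding P_def by (meson subsetD)
qed

text \<open>Chaining through points of consecutive intersections costs less than \<epsilon> per
  vertex of the path. Each edge lowers the level by at most one, so the bound on
  \<open>N + length p\<close> keeps all vertices at level N or deeper.\<close>

lemma dist_along_resolution_path:
  fixes d :: "'b \<Rightarrow> 'b \<Rightarrow> real" and \<epsilon> :: real
  assumes "Metric_space M d" "topspace X = M"
    and small: "\<And>v x y. v \<in> T \<Longrightarrow> N \<le> level v \<Longrightarrow> x \<in> K v \<Longrightarrow> y \<in> K v \<Longrightarrow> d x y < \<epsilon>"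
    and "graph_path T (resolution T A \<phi> K) w p v" "N + length p \<le> Suc (level w)"
    and "x \<in> K w" "y \<in> K v"
  shows "d x y < length p * \<epsilon>"
  using assms(4-7)
proof (induction p arbitrary: w x)
  case Nil
  then show ?case by (simp add: graph_path_def)
next
  case (Cons a p)
  interpret M: Metric_space M d by fact
  show ?case
  proof (cases "p = []")
    case True
    then have "w \<in> T" "v = w"
      using Cons.prems(1) by (auto simp: graph_path_def)
    then show ?thesis using Cons.prems True small[of w x y] by simp
  next
    case False
    then have a: "w = a" "a \<in> T" "resolution T A \<phi> K a (hd p) = 1"
      and p: "graph_path T (resolution T A \<phi> K) (hd p) p v"
      using Cons.prems(1) by (auto simp: graph_path_Cons)
    have b: "hd p \<in> T" "v \<in> T"
      using p by (auto simp: graph_path_def)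
    obtain z where z: "z \<in> K a" "z \<in> K (hd p)" and l: "level a \<le> Suc (level (hd p))"
      using resolution_adjacent[OF a(2) b(1) a(3)] by blast
    have "d z y < length p * \<epsilon>"
      by (rule Cons.IH[OF p]) (use Cons.prems l a z in auto)
    moreover have "d x z < \<epsilon>"
      by (rule small[of a]) (use Cons.prems a z in auto)
    moreover have "x \<in> M" "y \<in> M" "z \<in> M"
      using K_closed[THEN closedin_subset] a b z Cons.prems assms(2) by auto
    ultimately show ?thesis
      using M.triangle[of x z y] by (simp add: algebra_simps)
  qed
qed

lemma ray_point_eq_if_bounded:
  assumes "\<omega> \<in> rays T A \<phi>" "\<tau> \<in> rays T A \<phi>"
    and bdd: "\<And>n. n \<ge> 1 \<Longrightarrow> graph_dist T (resolution T A \<phi> K) (\<omega> n) (\<tau> n) \<le> enat C"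
  shows "ray_point K \<omega> = ray_point K \<tau>"
proof (rule ccontr)
  assume ne: "ray_point K \<omega> \<noteq> ray_point K \<tau>"
  obtain M d where M: "Metric_space M d" "X = Metric_space.mtopology M d"
    using metrizable unfolding metrizable_space_def by blast
  interpret M: Metric_space M d by fact
  have top: "topspace X = M" using M(2) by simp
  let ?\<delta> = "d (ray_point K \<omega>) (ray_point K \<tau>)"
  have "?\<delta> > 0"
    using ne ray_point_topspace assms(1,2) top M.mdist_pos_less by metis
  \<comment> \<open>A path with at most C edges has at most C + 1 vertices, so cells of this size
    cannot bridge the distance \<delta>.\<close>
  then have "?\<delta> / (C + 1) > 0" by simp
  then obtain N where N: "\<And>v x y. v \<in> T \<Longrightarrow> N \<le> level v \<Longrightarrow> x \<in> K v \<Longrightarrow> y \<in> K v \<Longrightarrow>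
      d x y < ?\<delta> / (C + 1)"
    using K_uniformly_small[OF M] by blast
  \<comment> \<open>C edges from level N + C still end no higher than level N; the extra 1 only
    guarantees that n is at least 1, as the bound on distances demands.\<close>
  define n where "n = N + C + 1"
  have "n \<ge> 1" by (simp add: n_def)
  note bd = bdd[OF this]
  then have "graph_dist T (resolution T A \<phi> K) (\<omega> n) (\<tau> n) \<noteq> \<infinity>"
    by (metis enat_ord_simps(5) enat.distinct(1))
  then obtain p where p: "graph_path T (resolution T A \<phi> K) (\<omega> n) p (\<tau> n)"
    "graph_dist T (resolution T A \<phi> K) (\<omega> n) (\<tau> n) = enat (length p - 1)"
    by (rule graph_dist_attained)
  then have len: "length p \<le> C + 1" using bd by simp
  have "?\<delta> < length p * (?\<delta> / (C + 1))"
    by (rule dist_along_resolution_path[OF M(1) top N p(1)])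
      (use len ray_point_in[OF assms(1)] ray_point_in[OF assms(2)] level_ray[OF assms(1), of n]
        in \<open>auto simp: n_def\<close>)
  also have "\<dots> \<le> (C + 1) * (?\<delta> / (C + 1))"
    using len \<open>?\<delta> > 0\<close> by (intro mult_right_mono) auto
  also have "\<dots> = ?\<delta>" by simp
  finally show False by simp
qed

section \<open>The relation as the kernel of \<sigma>, and the homeomorphism\<close>

lemma ray_rel_iff:
  "(\<omega>, \<tau>) \<in> ray_rel T A \<phi> K \<longleftrightarrow>
     \<omega> \<in> rays T A \<phi> \<and> \<tau> \<in> rays T A \<phi> \<and> ray_point K \<omega> = ray_point K \<tau>"
proof (cases "\<omega> \<in> rays T A \<phi> \<and> \<tau> \<in> rays T A \<phi>")
  case True
  let ?f = "\<lambda>n. graph_dist T (resolution T A \<phi> K) (\<omega> n) (\<tau> n)"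
  have "(SUP n\<in>{1..}. ?f n) < \<infinity> \<longleftrightarrow> ray_point K \<omega> = ray_point K \<tau>"
  proof
    assume "(SUP n\<in>{1..}. ?f n) < \<infinity>"
    then obtain C where C: "(SUP n\<in>{1..}. ?f n) = enat C" by auto
    have "?f n \<le> enat C" if "n \<ge> 1" for n
      unfolding C[symmetric] by (rule SUP_upper) (use that in simp)
    then show "ray_point K \<omega> = ray_point K \<tau>"
      using ray_point_eq_if_bounded True by blast
  next
    assume "ray_point K \<omega> = ray_point K \<tau>"
    then have "(SUP n\<in>{1..}. ?f n) \<le> 1"
      using graph_dist_resolution_le_1 True by (intro SUP_least) blast
    then show "(SUP n\<in>{1..}. ?f n) < \<infinity>"
      by (rule order_le_less_trans) (simp add: one_enat_def)
  qed
  then show ?thesis using True by (simp add: ray_rel_def)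
qed (auto simp: ray_rel_def)

lemma equiv_ray_rel: "equiv (rays T A \<phi>) (ray_rel T A \<phi> K)"
  by (rule equivI) (auto simp: refl_on_def sym_on_def trans_on_def ray_rel_iff)

text \<open>As \<sigma> is h after the projection to classes, and both \<sigma> and the projection
  are quotient maps, h is one too. It is injective because the classes are the fibres of \<sigma>,
  hence a homeomorphism.\<close>

lemma ray_quotient_homeomorphic:
  "\<exists>h. (\<forall>\<omega>\<in>rays T A \<phi>. h (ray_rel T A \<phi> K `` {\<omega>}) = ray_point K \<omega>) \<and>
     homeomorphic_map (quotient_topology ray_topology (ray_rel T A \<phi> K)) X h"
proof -
  let ?r = "ray_rel T A \<phi> K"
  \<comment> \<open>On each class \<sigma> is constant, so the image is a singleton and no
    representative has to be chosen.\<close>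
  define h where "h E = the_elem (ray_point K ` E)" for E
  have h: "h (?r `` {\<omega>}) = ray_point K \<omega>" if "\<omega> \<in> rays T A \<phi>" for \<omega>
  proof -
    have "ray_point K ` (?r `` {\<omega>}) = {ray_point K \<omega>}"
      using that by (auto simp: ray_rel_iff)
    then show ?thesis by (simp add: h_def)
  qed
  have "quotient_map ray_topology X (h \<circ> (\<lambda>\<omega>. ?r `` {\<omega>}))"
    using quotient_map_ray_point
    by (rule quotient_map_eq) (simp add: h topspace_ray_topology)
  then have "quotient_map (quotient_topology ray_topology ?r) X h"
    using quotient_map_compose_eq[OF quotient_map_quotient_topology] by blast
  moreover have "inj_on h (topspace (quotient_topology ray_topology ?r))"
    unfolding topspace_quotient_topology topspace_ray_topology
  proof (rule inj_onI)
    fix E F assume "E \<in> rays T A \<phi> // ?r" "F \<in> rays T A \<phi> // ?r" "h E = h F"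
    then obtain \<omega> \<tau> where "\<omega> \<in> rays T A \<phi>" "\<tau> \<in> rays T A \<phi>" "E = ?r `` {\<omega>}" "F = ?r `` {\<tau>}"
      by (auto elim!: quotientE)
    with \<open>h E = h F\<close> show "E = F"
      by (auto simp: h ray_rel_iff)
  qed
  ultimately have "homeomorphic_map (quotient_topology ray_topology ?r) X h"
    by (simp add: homeomorphic_map_def)
  then show ?thesis using h by blast
qed

end

theorem theorem7p5:
  fixes T :: "'a set" and A :: "'a \<Rightarrow> 'a \<Rightarrow> nat" and \<phi> :: 'a
    and X :: "'b topology" and K :: "'a \<Rightarrow> 'b set"
  assumes "countable T" and "infinite T"
    and "adjacency_matrix T A" and "locally_finite_graph T A" and "tree_graph T A"
    and "\<phi> \<in> T"
    and "compact_space X" and "metrizable_space X" and "\<forall>x\<in>topspace X. \<not> openin X {x}"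
    and "partition_of X T A \<phi> K"
  shows "equiv (rays T A \<phi>) (ray_rel T A \<phi> K) \<and>
    (\<forall>\<omega>\<in>rays T A \<phi>. \<forall>\<tau>\<in>rays T A \<phi>.
       (\<omega>, \<tau>) \<in> ray_rel T A \<phi> K \<longleftrightarrow> ray_point K \<omega> = ray_point K \<tau>) \<and>
    (\<exists>h. (\<forall>\<omega>\<in>rays T A \<phi>. h (ray_rel T A \<phi> K `` {\<omega>}) = ray_point K \<omega>) \<and>
       homeomorphic_map
         (quotient_topology (Metric_space.mtopology (rays T A \<phi>) ray_dist) (ray_rel T A \<phi> K)) X h)"
proof -
  interpret tree_partition T A \<phi> X K
    by unfold_locales (fact assms)+
  show ?thesis
    using equiv_ray_rel ray_rel_iff ray_quotient_homeomorphic by blast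
qed

end
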